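(* Let $m,n\ge 2$ be integers and let $S=\{s_{1},s_{2},\ldots,s_{n}\}$ be a set of $n$ distinct positive integers. Then the $m$th-order $n$-dimensional GCD tensor $\mathcal{T}_{[S]}$ on $S$ is a strongly completely positive tensor.
   Context: $\mathbb{R}^{[m,n]}$ denotes the set of real $m$th-order $n$-dimensional tensors $\mathcal{A}=(a_{i_1 i_2\ldots i_m})$, $1\le i_1,\ldots,i_m\le n$. $\mathbb{R}^n_+$ is the set of (entrywise) nonnegative vectors in $\mathbb{R}^n$. GCD tensor: for $S=\{s_1,\ldots,s_n\}$ with $n$ distinct positive integers (listed in a fixed order), $\mathcal{T}_{[S]}=(t_{i_1\ldots i_m})\in\mathbb{R}^{[m,n]}$ with $t_{i_1 i_2\ldots i_m}=\gcd(s_{i_1},s_{i_2},\ldots,s_{i_m})$. For $v\in\mathbb{R}^n$, $v^{\otimes m}\in\mathbb{R}^{[m,n]}$ is the $m$-fold outer product, with entries $v_{i_1}v_{i_2}\cdots v_{i_m}$. A symmetric tensor $\mathcal{A}\in\mathbb{R}^{[m,n]}$ (entries invariant under permutation of the indices) is completely positive (CP) if there exist $v_1,\ldots,v_r\in\mathbb{R}^n_+$ with $\mathcal{A}=(v_1)^{\otimes m}+\cdots+(v_r)^{\otimes m}$. If moreover the vectors can be chosen with $\mathrm{span}\{v_1,\ldots,v_r\}=\mathbb{R}^n$, then $\mathcal{A}$ is strongly completely positive. *)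

theory Defs
  imports "HOL-Analysis.Analysis"
begin

text \<open>
  A real tensor of order \<open>m = CARD('m)\<close> and dimension \<open>n = CARD('n)\<close> is a family of real entries
  indexed by multi-indices \<open>(i\<^sub>1, \<dots>, i\<^sub>m)\<close>, and a multi-index is a function from the
  \<open>m\<close> index positions to the \<open>n\<close> coordinates.
\<close>

type_synonym ('m, 'n) tensor = "real ^ ('m \<Rightarrow> 'n)"

definition symmetric_tensor :: "('m::finite, 'n::finite) tensor \<Rightarrow> bool" where
  "symmetric_tensor A \<longleftrightarrow> (\<forall>p i. bij p \<longrightarrow> A $ (i \<circ> p) = A $ i)"

definition outer_power :: "real ^ 'n \<Rightarrow> ('m::finite, 'n::finite) tensor" where
  "outer_power v = (\<chi> i. \<Prod>k\<in>UNIV. v $ i k)"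

definition nonneg_vectors :: "(real ^ 'n) set" where
  "nonneg_vectors = {v. \<forall>j. 0 \<le> v $ j}"

definition cp_decomposition ::
    "('m::finite, 'n::finite) tensor \<Rightarrow> nat \<Rightarrow> (nat \<Rightarrow> real ^ 'n) \<Rightarrow> bool" where
  "cp_decomposition A r v \<longleftrightarrow>
     (\<forall>k\<in>{1..r}. v k \<in> nonneg_vectors) \<and> A = (\<Sum>k=1..r. outer_power (v k))"

definition completely_positive :: "('m::finite, 'n::finite) tensor \<Rightarrow> bool" where
  "completely_positive A \<longleftrightarrow> symmetric_tensor A \<and> (\<exists>r v. cp_decomposition A r v)"

definition strongly_completely_positive :: "('m::finite, 'n::finite) tensor \<Rightarrow> bool" where
  "strongly_completely_positive A \<longleftrightarrow>
     symmetric_tensor A \<and> (\<exists>r v. cp_decomposition A r v \<and> span (v ` {1..r}) = UNIV)"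

text \<open>The argument is the listing \<open>s\<close> of the elements of the underlying set of integers.\<close>

definition gcd_tensor :: "('n \<Rightarrow> nat) \<Rightarrow> ('m::finite, 'n::finite) tensor" where
  "gcd_tensor s = (\<chi> i. real (GCD k\<in>UNIV. s (i k)))"

end

theory Submission
  imports Defs "HOL-Number_Theory.Totient"
begin

text \<open>
  Gauss's identity \<open>g = (\<Sum>d | d dvd g. totient d)\<close> splits every entry of the GCD tensor over the
  divisors \<open>d\<close> of the greatest common divisor. Since \<open>d\<close> divides a greatest common divisor exactly
  when it divides each of the numbers, the coefficient of \<open>totient d\<close> is a product of indicators,
  one for each index position. The tensor is therefore a sum of outer powers of the nonnegative
  vectors \<open>divisor_vector m s d\<close>, the indicators of the multiples of \<open>d\<close> rescaled by the \<open>m\<close>-th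
  root of \<open>totient d\<close>; this is lemma \<open>gcd_tensor_eq_sum_outer_power\<close>.

  These vectors span because divisibility is triangular with respect to size: a nonzero vector
  \<open>a\<close> cannot be orthogonal to the divisor vector of \<open>s j\<close> when \<open>s j\<close> is the largest value at which
  \<open>a\<close> is nonzero, as \<open>j\<close> is then the only coordinate at which both vectors are nonzero. This is
  lemma \<open>span_divisor_vectors\<close>.
\<close>

definition divisor_vector :: "nat \<Rightarrow> ('n::finite \<Rightarrow> nat) \<Rightarrow> nat \<Rightarrow> real ^ 'n" where
  "divisor_vector m s d = (\<chi> j. if d dvd s j then root m (real (totient d)) else 0)"

lemma divisor_vector_nonneg: "divisor_vector m s d \<in> nonneg_vectors"
  by (simp add: divisor_vector_def nonneg_vectors_def real_root_ge_zero)

lemma symmetric_gcd_tensor: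
  fixes s :: "'n::finite \<Rightarrow> nat"
  shows "symmetric_tensor (gcd_tensor s :: ('m::finite, 'n) tensor)"
  unfolding symmetric_tensor_def
proof (intro allI impI)
  fix p :: "'m \<Rightarrow> 'm" and i :: "'m \<Rightarrow> 'n"
  assume "bij p"
  then have "range (\<lambda>k. s (i (p k))) = range (\<lambda>k. s (i k))"
    by (metis bij_is_surj image_image)
  then show "(gcd_tensor s :: ('m, 'n) tensor) $ (i \<circ> p) = gcd_tensor s $ i"
    by (simp add: gcd_tensor_def)
qed

text \<open>
  The \<open>m\<close>-th root is taken precisely so that the product over the \<open>m\<close> index positions gives back
  \<open>totient d\<close>.
\<close>

lemma outer_power_divisor_vector_nth:
  fixes s :: "'n::finite \<Rightarrow> nat" and i :: "'m::finite \<Rightarrow> 'n"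
  shows "(outer_power (divisor_vector CARD('m) s d) :: ('m, 'n) tensor) $ i
    = (if d dvd (GCD k\<in>UNIV. s (i k)) then real (totient d) else 0)"
proof (cases "\<forall>k. d dvd s (i k)")
  case True
  then have "d dvd (GCD k\<in>UNIV. s (i k))"
    by (auto intro: Gcd_greatest)
  with True show ?thesis
    by (simp add: outer_power_def divisor_vector_def)
next
  case False
  then have "\<not> d dvd (GCD k\<in>UNIV. s (i k))"
    by (meson Gcd_dvd dvd_trans rangeI)
  with False show ?thesis
    by (auto simp: outer_power_def divisor_vector_def)
qed

lemma gcd_tensor_eq_sum_outer_power:
  fixes s :: "'n::finite \<Rightarrow> nat"
  assumes pos: "\<And>j. s j > 0" and le: "\<And>j. s j \<le> r"
  shows "(gcd_tensor s :: ('m::finite, 'n) tensor)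
    = (\<Sum>d=1..r. outer_power (divisor_vector CARD('m) s d))"
proof (rule iffD2[OF vec_eq_iff], rule allI)
  fix i :: "'m \<Rightarrow> 'n"
  define g where "g = (GCD k\<in>UNIV. s (i k))"
  have g_dvd: "g dvd s (i k)" for k
    unfolding g_def by (rule Gcd_dvd) simp
  have "g > 0"
    using g_dvd pos by (metis dvd_pos_nat)
  moreover have "g \<le> r"
    using g_dvd pos le by (meson dvd_imp_le order_trans)
  ultimately have divs: "{d \<in> {1..r}. d dvd g} = {d. d dvd g}"
    by (auto dest: dvd_imp_le intro: Suc_leI dvd_pos_nat)
  have "(gcd_tensor s :: ('m, 'n) tensor) $ i = real (\<Sum>d | d dvd g. totient d)"
    by (simp add: gcd_tensor_def g_def totient_divisor_sum)
  also have "\<dots> = (\<Sum>d | d \<in> {1..r} \<and> d dvd g. real (totient d))"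
    using divs by simp
  also have "\<dots> = (\<Sum>d=1..r. if d dvd g then real (totient d) else 0)"
    by (rule sum.inter_filter) simp
  finally show "(gcd_tensor s :: ('m, 'n) tensor) $ i
      = (\<Sum>d=1..r. outer_power (divisor_vector CARD('m) s d)) $ i"
    by (simp add: outer_power_divisor_vector_nth g_def)
qed

lemma span_divisor_vectors:
  fixes s :: "'n::finite \<Rightarrow> nat"
  assumes "inj s" and pos: "\<And>j. s j > 0" and "m > 0"
  shows "span (divisor_vector m s ` range s) = UNIV"
proof (rule ccontr)
  assume "span (divisor_vector m s ` range s) \<noteq> UNIV"
  then obtain a :: "real ^ 'n" where "a \<noteq> 0"
    and orth: "\<And>x. x \<in> span (divisor_vector m s ` range s) \<Longrightarrow> a \<bullet> x = 0"
    using span_not_UNIV_orthogonal by blast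
  define J where "J = {j. a $ j \<noteq> 0}"
  have "J \<noteq> {}"
    using \<open>a \<noteq> 0\<close> by (auto simp: J_def vec_eq_iff)
  then have "Max (s ` J) \<in> s ` J"
    by (intro Max_in) auto
  then obtain j where "j \<in> J" and j: "s j = Max (s ` J)"
    by auto
  have disjoint_support: "a $ l * divisor_vector m s (s j) $ l = 0" if "l \<noteq> j" for l
  proof (cases "l \<in> J \<and> s j dvd s l")
    case True
    then have "s l \<le> s j" "s j \<le> s l"
      using j pos by (auto simp: dvd_imp_le)
    with that \<open>inj s\<close> show ?thesis
      by (auto dest: injD)
  qed (auto simp: J_def divisor_vector_def)
  have "0 = a \<bullet> divisor_vector m s (s j)"
    by (simp add: orth span_base)
  also have "\<dots> = (\<Sum>l\<in>UNIV. a $ l * divisor_vector m s (s j) $ l)"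
    by (simp add: inner_vec_def)
  also have "\<dots> = (\<Sum>l\<in>{j}. a $ l * divisor_vector m s (s j) $ l)"
    using disjoint_support by (intro sum.mono_neutral_right) auto
  also have "\<dots> = a $ j * root m (real (totient (s j)))"
    by (simp add: divisor_vector_def)
  finally show False
    using \<open>j \<in> J\<close> pos[of j] \<open>m > 0\<close> by (simp add: J_def)
qed

theorem theorem1p3:
  fixes S :: "nat set" and s :: "'n::finite \<Rightarrow> nat"
  assumes "CARD('m::finite) \<ge> 2" and "CARD('n) \<ge> 2"
    and "\<forall>x\<in>S. x > 0"
    and "bij_betw s UNIV S"
  shows "strongly_completely_positive (gcd_tensor s :: ('m, 'n) tensor)"
proof -
  have pos: "s j > 0" for j
    using assms(3,4) by (auto simp: bij_betw_def)
  have "inj s"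
    using assms(4) by (simp add: bij_betw_def)
  define r where "r = Max (range s)"
  have le: "s j \<le> r" for j
    by (simp add: r_def)
  define v where "v = divisor_vector CARD('m) s"
  have "cp_decomposition (gcd_tensor s :: ('m, 'n) tensor) r v"
    using gcd_tensor_eq_sum_outer_power[of s r, OF pos le]
    by (simp add: cp_decomposition_def v_def divisor_vector_nonneg)
  moreover have "range s \<subseteq> {1..r}"
    using pos le by (auto simp: Suc_le_eq)
  then have "span (v ` range s) \<subseteq> span (v ` {1..r})"
    by (intro span_mono image_mono)
  then have "span (v ` {1..r}) = UNIV"
    using span_divisor_vectors[of s "CARD('m)", OF \<open>inj s\<close> pos] by (auto simp: v_def)
  ultimately show ?thesis
    unfolding strongly_completely_positive_def using symmetric_gcd_tensor by blast
qed

end
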